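(* Let $d\ge 1$ and $k\ge 2$ be integers, and set $$\eta_d(k)=\sum_{i=0}^{d}\binom{k-2}{i}.$$ Let $X$ be a finite subset of $\mathbb{R}^d$, and suppose that each point of $X$ is painted with one of $k$ colors. If every subset of $X$ with at most $(d+1)\cdot\eta_d(k)+k$ points can be partitioned by hyperplanes along the colors, then $X$ itself can be partitioned by hyperplanes along the colors.
   Context: A hyperplane $h$ in $\mathbb{R}^d$ has two associated open halfspaces $h^+$ and $h^-$; it separates two points if one lies in $h^+$ and the other lies in $h^-$. Let $X\subset\mathbb{R}^d$ be a finite set each of whose points is painted with one of $k$ colors. A subset $S$ of $X$ can be partitioned by hyperplanes along the colors if there is a family $\mathcal{F}$ of hyperplanes such that: (1) every hyperplane in $\mathcal{F}$ avoids the points of $S$ (contains no point of $S$); (2) for any two points of $S$ with different colors, there is a hyperplane in $\mathcal{F}$ separating them; (3) no hyperplane in $\mathcal{F}$ separates points of $S$ with the same color. Binomial coefficients $\binom{n}{i}$ with $0\le n<i$ are $0$. *)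

theory Defs
  imports "HOL-Analysis.Analysis"
begin

definition hyperplane :: "'a::euclidean_space set \<Rightarrow> bool" where
  "hyperplane h \<longleftrightarrow> (\<exists>a b. a \<noteq> 0 \<and> h = {x. a \<bullet> x = b})"

text \<open>
  The equation of \<open>h\<close> is unique up to a nonzero factor; a negative factor exchanges the two
  open halfspaces, so the existential quantifier makes this relation symmetric in \<open>p\<close> and \<open>q\<close>.
\<close>

definition separates :: "'a::euclidean_space set \<Rightarrow> 'a \<Rightarrow> 'a \<Rightarrow> bool" where
  "separates h p q \<longleftrightarrow>
     (\<exists>a b. a \<noteq> 0 \<and> h = {x. a \<bullet> x = b} \<and> p \<in> {x. a \<bullet> x > b} \<and> q \<in> {x. a \<bullet> x < b})"

definition partitionable_along_colors ::
  "('a::euclidean_space \<Rightarrow> 'c) \<Rightarrow> 'a set \<Rightarrow> bool" where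
  "partitionable_along_colors c S \<longleftrightarrow>
     (\<exists>F. (\<forall>h\<in>F. hyperplane h) \<and>
          (\<forall>h\<in>F. h \<inter> S = {}) \<and>
          (\<forall>p\<in>S. \<forall>q\<in>S. c p \<noteq> c q \<longrightarrow> (\<exists>h\<in>F. separates h p q)) \<and>
          (\<forall>h\<in>F. \<forall>p\<in>S. \<forall>q\<in>S. c p = c q \<longrightarrow> \<not> separates h p q))"

text \<open>Intended for \<open>k \<ge> 2\<close>, so that the subtraction on \<open>nat\<close> does not truncate.\<close>

definition eta :: "nat \<Rightarrow> nat \<Rightarrow> nat" where
  "eta d k = (\<Sum>i=0..d. (k - 2) choose i)"

end

theory Submission
  imports Defs
begin

text \<open>
  A set \<open>S\<close> can be partitioned along the colors iff any two colors \<open>i \<noteq> j\<close> occurring in \<open>S\<close> are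
  split by a set \<open>D\<close> of colors such that the points with color in \<open>D\<close> are strictly separated by a
  hyperplane from the remaining ones. Suppose \<open>X\<close> violates this for the colors \<open>i\<close> and \<open>j\<close>, and
  pick one point of each color. By duality, the sets \<open>D\<close> splitting \<open>i\<close> from \<open>j\<close> that are separable
  on the chosen points correspond to cells of an arrangement of at most \<open>k - 2\<close> hyperplanes in a
  \<open>d\<close>-dimensional affine space, so there are at most \<open>\<eta>\<^sub>d(k)\<close> of them. Each one is not separable on
  \<open>X\<close>, and by Helly's theorem this is witnessed by the chosen point of color \<open>i\<close> together with at
  most \<open>d + 1\<close> further points. The chosen points and all the witnesses form a subset with at most
  \<open>(d + 1) \<eta>\<^sub>d(k) + k\<close> points that cannot be partitioned.
\<close>

section \<open>Strict separation and its relation to partitions along colors\<close>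

text \<open>The normal vector may be zero, so an empty set is separable from every set.\<close>

definition strictly_separable :: "'a::real_inner set \<Rightarrow> 'a set \<Rightarrow> bool" where
  "strictly_separable A B \<longleftrightarrow> (\<exists>a b. (\<forall>x\<in>A. a \<bullet> x > b) \<and> (\<forall>x\<in>B. a \<bullet> x < b))"

lemma strictly_separable_mono:
  assumes "strictly_separable A B" "A' \<subseteq> A" "B' \<subseteq> B"
  shows "strictly_separable A' B'"
  using assms unfolding strictly_separable_def by (meson subsetD)

text \<open>\<open>separates\<close> admits any equation of the hyperplane. Were \<open>x\<close>
  and \<open>y\<close> on opposite sides for some equation, their segment would meet the hyperplane,
  yet it stays in a convex open halfspace.\<close>

lemma not_separates_same_side:
  assumes "a \<bullet> x > b" "a \<bullet> y > b"
  shows "\<not> separates {z. a \<bullet> z = b} x y"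
proof
  assume "separates {z. a \<bullet> z = b} x y"
  then obtain a' b' where h: "{z. a \<bullet> z = b} = {z. a' \<bullet> z = b'}"
    and x: "a' \<bullet> x > b'" and y: "a' \<bullet> y < b'"
    unfolding separates_def by auto
  define u where "u = (b' - a' \<bullet> y) / (a' \<bullet> x - a' \<bullet> y)"
  define z where "z = (1 - u) *\<^sub>R y + u *\<^sub>R x"
  have u: "0 \<le> u" "u \<le> 1"
    using x y by (auto simp: u_def field_simps)
  have "a' \<bullet> z = a' \<bullet> y + u * (a' \<bullet> x - a' \<bullet> y)"
    by (simp add: z_def inner_add_right algebra_simps)
  also have "\<dots> = b'"
    using x y by (simp add: u_def)
  finally have "a \<bullet> z = b"
    using h by blast
  moreover have "z \<in> {z. a \<bullet> z > b}"
    using convexD_alt[OF convex_halfspace_gt, of y b a x u] assms u by (simp add: z_def)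
  ultimately show False
    by simp
qed

lemma partitionable_along_colors_iff:
  "partitionable_along_colors c S \<longleftrightarrow>
     (\<forall>p\<in>S. \<forall>q\<in>S. c p \<noteq> c q \<longrightarrow>
        (\<exists>D. c p \<in> D \<and> c q \<notin> D \<and> strictly_separable {x\<in>S. c x \<in> D} {x\<in>S. c x \<notin> D}))"
  (is "_ \<longleftrightarrow> ?R")
proof
  assume "partitionable_along_colors c S"
  then obtain F where avoid: "\<forall>h\<in>F. h \<inter> S = {}"
    and sep: "\<forall>p\<in>S. \<forall>q\<in>S. c p \<noteq> c q \<longrightarrow> (\<exists>h\<in>F. separates h p q)"
    and same: "\<forall>h\<in>F. \<forall>p\<in>S. \<forall>q\<in>S. c p = c q \<longrightarrow> \<not> separates h p q"
    unfolding partitionable_along_colors_def by blast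
  show ?R
  proof (intro ballI impI)
    fix p q assume pq: "p \<in> S" "q \<in> S" "c p \<noteq> c q"
    then obtain h where h: "h \<in> F" "separates h p q"
      using sep by blast
    then obtain a b where ab: "a \<noteq> 0" "h = {x. a \<bullet> x = b}" "a \<bullet> p > b" "a \<bullet> q < b"
      unfolding separates_def by auto
    have ne: "a \<bullet> x \<noteq> b" if "x \<in> S" for x
      using bspec[OF avoid h(1)] ab(2) that by auto
    have pos: "a \<bullet> x > b" if "x \<in> S" "y \<in> S" "c x = c y" "a \<bullet> y > b" for x y
    proof (rule ccontr)
      assume "\<not> a \<bullet> x > b"
      then have "a \<bullet> x < b"
        using ne[OF that(1)] by linarith
      then have "separates h y x"
        unfolding separates_def using ab that(4) by blast
      then show False
        using same h(1) that(1-3) by metis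
    qed
    \<comment> \<open>By \<open>pos\<close>, each color of \<open>S\<close> lies wholly on one side
      of \<open>h\<close>; \<open>D\<close> collects those on the positive side.\<close>
    define D where "D = c ` {x\<in>S. a \<bullet> x > b}"
    have D: "c x \<in> D \<longleftrightarrow> a \<bullet> x > b" if "x \<in> S" for x
      using pos that unfolding D_def by auto
    have "strictly_separable {x\<in>S. c x \<in> D} {x\<in>S. c x \<notin> D}"
      unfolding strictly_separable_def using D ne by (intro exI[of _ a] exI[of _ b]) force
    moreover have "c p \<in> D" "c q \<notin> D"
      using D pq ab by auto
    ultimately show "\<exists>D. c p \<in> D \<and> c q \<notin> D \<and> strictly_separable {x\<in>S. c x \<in> D} {x\<in>S. c x \<notin> D}"
      by blast
  qed
next
  assume R: ?R
  \<comment> \<open>The largest admissible family: only the separation of different colors remains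
    to be shown.\<close>
  define F where "F = {h. hyperplane h \<and> h \<inter> S = {} \<and>
    (\<forall>p\<in>S. \<forall>q\<in>S. c p = c q \<longrightarrow> \<not> separates h p q)}"
  have "\<exists>h\<in>F. separates h p q" if pq: "p \<in> S" "q \<in> S" "c p \<noteq> c q" for p q
  proof -
    obtain D where D: "c p \<in> D" "c q \<notin> D"
      and "strictly_separable {x\<in>S. c x \<in> D} {x\<in>S. c x \<notin> D}"
      using R pq by blast
    then obtain a b where pos: "\<And>x. x \<in> S \<Longrightarrow> c x \<in> D \<Longrightarrow> a \<bullet> x > b"
      and neg: "\<And>x. x \<in> S \<Longrightarrow> c x \<notin> D \<Longrightarrow> a \<bullet> x < b"
      unfolding strictly_separable_def by blast
    have "a \<noteq> 0"
      using pos[OF pq(1) D(1)] neg[OF pq(2) D(2)] by auto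
    define h where "h = {x. a \<bullet> x = b}"
    have "\<not> separates h x y" if "x \<in> S" "y \<in> S" "c x = c y" for x y
    proof (cases "c x \<in> D")
      case True
      then show ?thesis
        unfolding h_def using pos that by (intro not_separates_same_side) auto
    next
      case False
      have "h = {x. (- a) \<bullet> x = - b}"
        by (auto simp: h_def)
      moreover have "\<not> separates {x. (- a) \<bullet> x = - b} x y"
        using neg that False by (intro not_separates_same_side) auto
      ultimately show ?thesis
        by simp
    qed
    moreover have "hyperplane h"
      unfolding hyperplane_def h_def using \<open>a \<noteq> 0\<close> by blast
    moreover have "h \<inter> S = {}"
      unfolding h_def using pos neg by force
    ultimately have "h \<in> F"
      unfolding F_def by blast
    moreover have "separates h p q"
      unfolding separates_def h_def using \<open>a \<noteq> 0\<close> pos[OF pq(1) D(1)] neg[OF pq(2) D(2)] by blast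
    ultimately show ?thesis
      by blast
  qed
  then show "partitionable_along_colors c S"
    unfolding partitionable_along_colors_def by (intro exI[of _ F]) (auto simp: F_def)
qed

section \<open>Small witnesses of non-separability from Helly's theorem\<close>

lemma Helly_witness:
  fixes \<F> :: "'a::euclidean_space set set"
  assumes "finite \<F>" "\<forall>s\<in>\<F>. convex s" "\<Inter>\<F> = {}"
  obtains \<G> where "\<G> \<subseteq> \<F>" "card \<G> \<le> DIM('a) + 1" "\<Inter>\<G> = {}"
proof (cases "card \<F> \<ge> DIM('a) + 1")
  case True
  then show ?thesis
    using Helly[of \<F>] assms that by (metis order_refl)
next
  case False
  then show ?thesis
    using assms that[of \<F>] by simp
qed

text \<open>
  A separating functional can be scaled so that it is larger by exactly \<open>1\<close> at \<open>p\<close> than on the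
  hyperplane. This leaves one convex condition on a vector of the original space for each of the
  other points, so Helly's theorem yields \<open>d + 1\<close> points besides \<open>p\<close>.
\<close>

lemma Kirchberger_pointed:
  fixes P Q :: "'a::euclidean_space set"
  assumes "finite P" "finite Q" "p \<in> P" "P \<inter> Q = {}" "\<not> strictly_separable P Q"
  obtains T where "T \<subseteq> P \<union> Q" "card T \<le> DIM('a) + 1"
    "\<not> strictly_separable (insert p (P \<inter> T)) (Q \<inter> T)"
proof -
  \<comment> \<open>The vectors \<open>a\<close> for which \<open>x\<close> lies on its proper side
    of the hyperplane with threshold \<open>a \<bullet> p - 1\<close>; for \<open>x = p\<close> this
    is no restriction.\<close>
  define C where "C x = (if x \<in> P then {a. (x - p) \<bullet> a > -1} else {a. (x - p) \<bullet> a < -1})" for x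
  have "\<Inter>(C ` (P \<union> Q)) = {}"
  proof (rule ccontr)
    assume "\<Inter>(C ` (P \<union> Q)) \<noteq> {}"
    then obtain a where a: "\<And>x. x \<in> P \<union> Q \<Longrightarrow> a \<in> C x"
      by blast
    have "a \<bullet> x > a \<bullet> p - 1" if "x \<in> P" for x
      using a[of x] that by (simp add: C_def inner_diff_left inner_diff_right inner_commute)
    moreover have "a \<bullet> x < a \<bullet> p - 1" if "x \<in> Q" for x
      using a[of x] that assms(4) by (auto simp: C_def inner_diff_left inner_diff_right inner_commute split: if_splits)
    ultimately show False
      using assms(5) unfolding strictly_separable_def by blast
  qed
  moreover have "\<forall>s\<in>C ` (P \<union> Q). convex s"
    by (auto simp: C_def convex_halfspace_gt convex_halfspace_lt)
  ultimately obtain \<G> where \<G>: "\<G> \<subseteq> C ` (P \<union> Q)" "card \<G> \<le> DIM('a) + 1" "\<Inter>\<G> = {}"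
    using Helly_witness[of "C ` (P \<union> Q)"] assms(1,2) by blast
  \<comment> \<open>One point per chosen set, so that \<open>T\<close> is no larger than
    \<open>\<G>\<close>.\<close>
  then obtain T where T: "T \<subseteq> P \<union> Q" "inj_on C T" "\<G> = C ` T"
    by (meson subset_image_inj)
  have "\<not> strictly_separable (insert p (P \<inter> T)) (Q \<inter> T)"
  proof
    assume "strictly_separable (insert p (P \<inter> T)) (Q \<inter> T)"
    then obtain a b where p: "a \<bullet> p > b" and pos: "\<And>x. x \<in> P \<inter> T \<Longrightarrow> a \<bullet> x > b"
      and neg: "\<And>x. x \<in> Q \<inter> T \<Longrightarrow> a \<bullet> x < b"
      unfolding strictly_separable_def by blast
    define a' where "a' = a /\<^sub>R (a \<bullet> p - b)"
    have a': "(x - p) \<bullet> a' = (a \<bullet> x - a \<bullet> p) / (a \<bullet> p - b)" for x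
      by (simp add: a'_def inner_diff_left inner_diff_right inner_commute divide_inverse mult.commute)
    have "a' \<in> C x" if "x \<in> T" for x
    proof (cases "x \<in> P")
      case True
      then show ?thesis
        using pos[of x] p that by (simp add: C_def a' field_simps)
    next
      case False
      then show ?thesis
        using neg[of x] p that T(1) by (auto simp add: C_def a' field_simps)
    qed
    then show False
      using \<G>(3) T(3) by blast
  qed
  then show ?thesis
    using that T \<G>(2) by (simp add: card_image)
qed

section \<open>Counting cells of hyperplane arrangements\<close>

text \<open>The cells that the hyperplanes cut out of \<open>T\<close>, each encoded by the indices
  on whose positive side it lies.\<close>

definition sign_patterns :: "('i \<Rightarrow> 'a::real_inner) \<Rightarrow> ('i \<Rightarrow> real) \<Rightarrow> 'i set \<Rightarrow> 'a set \<Rightarrow> 'i set set" where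
  "sign_patterns n r I T =
     {J. J \<subseteq> I \<and> (\<exists>y\<in>T. (\<forall>m\<in>J. n m \<bullet> y > r m) \<and> (\<forall>m\<in>I - J. n m \<bullet> y < r m))}"

text \<open>
  Deletion and restriction: a pattern that extends in both ways to the index \<open>m\<close> is, by convexity
  of cells, a pattern on the hyperplane of \<open>m\<close>.
\<close>

lemma card_sign_patterns_le:
  fixes T :: "'a::euclidean_space set"
  assumes "finite I" "affine T" "aff_dim T < int d"
  shows "card (sign_patterns n r I T) \<le> (\<Sum>t<d. card I choose t)"
  using assms
proof (induction I arbitrary: T d rule: finite_induct)
  case empty
  show ?case
  \<comment> \<open>As \<open>d\<close> strictly exceeds the dimension, \<open>d = 0\<close> means
    that \<open>T\<close> is empty, matching the empty sum.\<close>
  proof (cases d)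
    case 0
    then have "T = {}"
      using empty.prems by simp
    then show ?thesis
      by (simp add: sign_patterns_def)
  next
    case (Suc d')
    have "sign_patterns n r {} T \<subseteq> {{}}"
      by (auto simp: sign_patterns_def)
    then have "card (sign_patterns n r {} T) \<le> 1"
      using card_mono[of "{{}}" "sign_patterns n r {} T"] by simp
    also have "1 \<le> (\<Sum>t<d. card {} choose t)"
      by (simp add: Suc sum.lessThan_Suc_shift del: sum.lessThan_Suc)
    finally show ?thesis .
  qed
next
  case (insert m I)
  define Z where "Z = sign_patterns n r (insert m I) T"
  \<comment> \<open>\<open>A\<close> and \<open>B\<close> hold the patterns on \<open>I\<close> that
    extend to the positive and the negative side of \<open>m\<close>; those in both are counted
    twice in \<open>Z\<close>.\<close>
  define A where "A = (\<lambda>J. J - {m}) ` {J\<in>Z. m \<in> J}"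
  define B where "B = {J\<in>Z. m \<notin> J}"
  define H where "H = T \<inter> {y. n m \<bullet> y = r m}"
  have finZ: "finite Z"
    unfolding Z_def sign_patterns_def using insert.hyps by (auto intro: finite_subset[of _ "Pow (insert m I)"])
  have A: "\<exists>y\<in>T. n m \<bullet> y > r m \<and> (\<forall>l\<in>J. n l \<bullet> y > r l) \<and> (\<forall>l\<in>I - J. n l \<bullet> y < r l)"
    and AI: "J \<subseteq> I" if "J \<in> A" for J
    using that insert.hyps unfolding A_def Z_def sign_patterns_def by auto
  have B: "\<exists>y\<in>T. n m \<bullet> y < r m \<and> (\<forall>l\<in>J. n l \<bullet> y > r l) \<and> (\<forall>l\<in>I - J. n l \<bullet> y < r l)"
    and BI: "J \<subseteq> I" if "J \<in> B" for J
    using that insert.hyps unfolding B_def Z_def sign_patterns_def by auto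
  have "card Z = card {J\<in>Z. m \<in> J} + card B"
    using card_Int_Diff[OF finZ, of "{J. m \<in> J}"] by (simp add: B_def Int_def set_diff_eq)
  also have "card {J\<in>Z. m \<in> J} = card A"
    unfolding A_def by (intro card_image[symmetric] inj_onI) auto
  also have "card A + card B = card (A \<union> B) + card (A \<inter> B)"
    using finZ by (intro card_Un_Int) (auto simp: A_def B_def)
  finally have cardZ: "card Z = card (A \<union> B) + card (A \<inter> B)" .
  have fin: "finite (sign_patterns n r I U)" for U
    unfolding sign_patterns_def using insert.hyps by (auto intro: finite_subset[of _ "Pow I"])
  have "A \<union> B \<subseteq> sign_patterns n r I T"
  proof
    fix J assume "J \<in> A \<union> B"
    then have "\<exists>y\<in>T. (\<forall>l\<in>J. n l \<bullet> y > r l) \<and> (\<forall>l\<in>I - J. n l \<bullet> y < r l)"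
    proof
      assume "J \<in> A"
      from A[OF this] show ?thesis
        by blast
    next
      assume "J \<in> B"
      from B[OF this] show ?thesis
        by blast
    qed
    moreover have "J \<subseteq> I"
      using \<open>J \<in> A \<union> B\<close> AI BI by blast
    ultimately show "J \<in> sign_patterns n r I T"
      unfolding sign_patterns_def by simp
  qed
  then have le1: "card (A \<union> B) \<le> (\<Sum>t<d. card I choose t)"
    using card_mono[OF fin] insert.IH insert.prems by (meson le_trans)
  show ?case
  proof (cases "A \<inter> B = {}")
    case True
    have "(\<Sum>t<d. card I choose t) \<le> (\<Sum>t<d. card (insert m I) choose t)"
      using insert.hyps by (intro sum_mono binomial_right_mono) auto
    then show ?thesis
      using cardZ le1 True by (simp add: Z_def)
  next
    case False
    then obtain J0 where "J0 \<in> A" "J0 \<in> B"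
      by blast
    then obtain y0 where y0: "y0 \<in> T" "n m \<bullet> y0 > r m"
      using A by blast
    then obtain d' where d: "d = Suc d'"
      using insert.prems by (cases d) auto
    have affH: "affine H"
      unfolding H_def using insert.prems affine_hyperplane by (intro affine_Int) auto
    moreover have "aff_dim H < aff_dim T"
    proof (rule aff_dim_psubset)
      have "y0 \<notin> H" "H \<subseteq> T"
        using y0 by (auto simp: H_def)
      then have "H \<subset> T"
        using y0(1) by blast
      then show "affine hull H \<subset> affine hull T"
        using affH insert.prems(1) by (simp add: hull_same)
    qed
    ultimately have IH: "card (sign_patterns n r I H) \<le> (\<Sum>t<d'. card I choose t)"
      using insert.IH[of H d'] insert.prems d by simp
    have "A \<inter> B \<subseteq> sign_patterns n r I H"
    proof
      fix J assume J: "J \<in> A \<inter> B"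
      then obtain y where y: "y \<in> T" "n m \<bullet> y > r m" "\<forall>l\<in>J. n l \<bullet> y > r l" "\<forall>l\<in>I - J. n l \<bullet> y < r l"
        using A by blast
      from J obtain z where z: "z \<in> T" "n m \<bullet> z < r m" "\<forall>l\<in>J. n l \<bullet> z > r l" "\<forall>l\<in>I - J. n l \<bullet> z < r l"
        using B by blast
      \<comment> \<open>The parameter at which the segment from \<open>z\<close> to \<open>y\<close>
        crosses the hyperplane of \<open>m\<close>.\<close>
      define u where "u = (r m - n m \<bullet> z) / (n m \<bullet> y - n m \<bullet> z)"
      define w where "w = (1 - u) *\<^sub>R z + u *\<^sub>R y"
      have u: "0 \<le> u" "u \<le> 1"
        using y z by (auto simp: u_def field_simps)
      have "n m \<bullet> w = n m \<bullet> z + u * (n m \<bullet> y - n m \<bullet> z)"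
        by (simp add: w_def inner_add_right algebra_simps)
      also have "\<dots> = r m"
        using y z by (simp add: u_def)
      finally have "n m \<bullet> w = r m" .
      moreover have "w \<in> T"
        using insert.prems(1) y z unfolding w_def by (simp add: affine_alt)
      moreover have "n l \<bullet> w > r l" if "l \<in> J" for l
        using convexD_alt[OF convex_halfspace_gt, of z "r l" "n l" y u] y z u that
        by (simp add: w_def)
      moreover have "n l \<bullet> w < r l" if "l \<in> I - J" for l
        using convexD_alt[OF convex_halfspace_lt, of z "n l" "r l" y u] y z u that
        by (simp add: w_def)
      ultimately show "J \<in> sign_patterns n r I H"
        unfolding sign_patterns_def H_def using AI J by blast
    qed
    then have "card (A \<inter> B) \<le> (\<Sum>t<d'. card I choose t)"
      using card_mono[OF fin] IH by (meson le_trans)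
    then have "card Z \<le> (\<Sum>t<d. card I choose t) + (\<Sum>t<d'. card I choose t)"
      using cardZ le1 by simp
    \<comment> \<open>Pascal's rule, summed term by term.\<close>
    also have "\<dots> = (\<Sum>t<d. card (insert m I) choose t)"
      using insert.hyps by (simp add: d sum.lessThan_Suc_shift sum.distrib del: sum.lessThan_Suc)
    finally show ?thesis
      by (simp add: Z_def)
  qed
qed

text \<open>
  The affine functional \<open>x \<mapsto> a \<bullet> x - b\<close> is the point \<open>(a, b)\<close> of the dual space. Scaling puts the
  functionals that separate \<open>p i\<close> from \<open>p j\<close> into the affine hyperplane \<open>a \<bullet> (p i - p j) = 1\<close>, of
  dimension \<open>d\<close>, where the points of the other indices cut out hyperplanes.
\<close>

lemma card_separable_splittings_le:
  fixes p :: "'i \<Rightarrow> 'a::euclidean_space"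
  assumes "finite I" "i \<notin> I" "j \<notin> I" "p i \<noteq> p j"
  shows "card {J. J \<subseteq> I \<and> strictly_separable (p ` insert i J) (p ` insert j (I - J))}
           \<le> (\<Sum>t\<le>DIM('a). card I choose t)" (is "card ?S \<le> _")
proof -
  define v where "v = (p i - p j, 0 :: real)"
  define T where "T = {y. v \<bullet> y = 1}"
  \<comment> \<open>Pairing \<open>n m\<close> with \<open>(a, b)\<close> gives
    \<open>a \<bullet> p m - b\<close>.\<close>
  define n where "n m = (p m, - 1 :: real)" for m
  have "v \<noteq> 0"
    using assms(4) by (simp add: v_def zero_prod_def)
  then have dim: "aff_dim T < int (Suc DIM('a))"
    unfolding T_def by (simp add: aff_dim_hyperplane)
  have "?S \<subseteq> sign_patterns n (\<lambda>_. 0) I T"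
  proof
    fix J assume "J \<in> ?S"
    then obtain a b where J: "J \<subseteq> I" and pos: "\<And>m. m \<in> insert i J \<Longrightarrow> a \<bullet> p m > b"
      and neg: "\<And>m. m \<in> insert j (I - J) \<Longrightarrow> a \<bullet> p m < b"
      unfolding strictly_separable_def mem_Collect_eq by (metis imageI)
    define s where "s = a \<bullet> p i - a \<bullet> p j"
    have s: "s > 0"
      using pos[of i] neg[of j] by (simp add: s_def)
    define y where "y = (a /\<^sub>R s, b / s)"
    have "v \<bullet> y = (a \<bullet> p i - a \<bullet> p j) / s"
      by (simp add: v_def y_def inner_diff_left inner_diff_right inner_commute right_diff_distrib
          divide_inverse mult.commute)
    then have "y \<in> T"
      using s by (simp add: T_def s_def)
    moreover have ny: "n m \<bullet> y = (a \<bullet> p m - b) / s" for m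
      by (simp add: n_def y_def inner_commute right_diff_distrib divide_inverse mult.commute)
    then have "n m \<bullet> y > 0" if "m \<in> J" for m
      using pos[of m] s that by simp
    moreover have "n m \<bullet> y < 0" if "m \<in> I - J" for m
      using neg[of m] s that by (simp add: ny divide_neg_pos)
    ultimately show "J \<in> sign_patterns n (\<lambda>_. 0) I T"
      using J unfolding sign_patterns_def by blast
  qed
  moreover have "finite (sign_patterns n (\<lambda>_. 0) I T)"
    unfolding sign_patterns_def using assms(1) by (auto intro: finite_subset[of _ "Pow I"])
  ultimately have "card ?S \<le> card (sign_patterns n (\<lambda>_. 0) I T)"
    by (intro card_mono)
  also have "\<dots> \<le> (\<Sum>t<Suc DIM('a). card I choose t)"
    using assms(1) dim by (intro card_sign_patterns_le) (auto simp: T_def affine_hyperplane)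
  finally show ?thesis
    by (simp add: lessThan_Suc_atMost)
qed

section \<open>Assembling a small subset that cannot be partitioned\<close>

theorem theorem4p2:
  fixes X :: "(real ^ 'd) set" and c :: "real ^ 'd \<Rightarrow> nat" and d k :: nat
  assumes "d = CARD('d)"
    and "k \<ge> 2"
    and "finite X"
    and "c ` X \<subseteq> {..<k}"
    and "\<And>S. S \<subseteq> X \<Longrightarrow> card S \<le> (d + 1) * eta d k + k \<Longrightarrow> partitionable_along_colors c S"
  shows "partitionable_along_colors c X"
proof (rule ccontr)
  assume "\<not> partitionable_along_colors c X"
  then obtain p q where pq: "p \<in> X" "q \<in> X" "c p \<noteq> c q"
    and nosep: "\<And>D. c p \<in> D \<Longrightarrow> c q \<notin> D \<Longrightarrow>
      \<not> strictly_separable {x\<in>X. c x \<in> D} {x\<in>X. c x \<notin> D}"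
    unfolding partitionable_along_colors_iff by blast
  define i where "i = c p"
  define j where "j = c q"
  define K where "K = c ` X"
  define I where "I = K - {i, j}"
  define r where "r = inv_into X c"
  have r: "r m \<in> X" "c (r m) = m" if "m \<in> K" for m
    using that unfolding r_def K_def by (auto simp: inv_into_into f_inv_into_f)
  have ij: "i \<in> K" "j \<in> K" "i \<noteq> j"
    using pq by (auto simp: i_def j_def K_def)
  have finK: "finite K" and cardK: "card K \<le> k"
    using assms(3,4) card_mono[of "{..<k}" K] by (auto simp: K_def)
  have "card I = card K - 2"
    using ij finK by (simp add: I_def card_Diff_subset)
  then have cardI: "card I \<le> k - 2"
    using cardK by simp
  define \<D> where "\<D> = {J. J \<subseteq> I \<and> strictly_separable (r ` insert i J) (r ` insert j (I - J))}"
  have "card \<D> \<le> (\<Sum>t\<le>DIM(real^'d). card I choose t)"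
    unfolding \<D>_def
  proof (rule card_separable_splittings_le)
    show "r i \<noteq> r j"
      using r ij by metis
  qed (auto simp: I_def finK)
  also have "\<dots> \<le> (\<Sum>t\<le>d. (k - 2) choose t)"
    using assms(1) cardI by (auto intro!: sum_mono binomial_right_mono)
  finally have card\<D>: "card \<D> \<le> eta d k"
    by (simp add: eta_def atLeast0AtMost)
  \<comment> \<open>The pointed witness uses \<open>r i\<close> for every \<open>J\<close>; it is a
    representative anyway, so each \<open>J\<close> costs only \<open>d + 1\<close> further
    points.\<close>
  have "\<exists>T. T \<subseteq> X \<and> card T \<le> d + 1 \<and>
      \<not> strictly_separable (insert (r i) ({x\<in>X. c x \<in> insert i J} \<inter> T))
          ({x\<in>X. c x \<notin> insert i J} \<inter> T)" if "J \<in> \<D>" for J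
  proof -
    have "\<not> strictly_separable {x\<in>X. c x \<in> insert i J} {x\<in>X. c x \<notin> insert i J}"
      using that nosep[of "insert i J"] pq by (auto simp: \<D>_def I_def i_def j_def)
    moreover have "r i \<in> {x\<in>X. c x \<in> insert i J}"
      using r ij by simp
    ultimately obtain T where "T \<subseteq> {x\<in>X. c x \<in> insert i J} \<union> {x\<in>X. c x \<notin> insert i J}"
      "card T \<le> DIM(real^'d) + 1"
      "\<not> strictly_separable (insert (r i) ({x\<in>X. c x \<in> insert i J} \<inter> T))
          ({x\<in>X. c x \<notin> insert i J} \<inter> T)"
      using Kirchberger_pointed[of "{x\<in>X. c x \<in> insert i J}" "{x\<in>X. c x \<notin> insert i J}" "r i"]
        assms(3) by auto
    then show ?thesis
      using assms(1) by (intro exI[of _ T]) auto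
  qed
  then have "\<exists>T. \<forall>J\<in>\<D>. T J \<subseteq> X \<and> card (T J) \<le> d + 1 \<and>
      \<not> strictly_separable (insert (r i) ({x\<in>X. c x \<in> insert i J} \<inter> T J))
          ({x\<in>X. c x \<notin> insert i J} \<inter> T J)"
    by (intro bchoice ballI)
  then obtain T where T: "\<And>J. J \<in> \<D> \<Longrightarrow> T J \<subseteq> X" "\<And>J. J \<in> \<D> \<Longrightarrow> card (T J) \<le> d + 1"
    "\<And>J. J \<in> \<D> \<Longrightarrow> \<not> strictly_separable (insert (r i) ({x\<in>X. c x \<in> insert i J} \<inter> T J))
          ({x\<in>X. c x \<notin> insert i J} \<inter> T J)"
    by blast
  define S where "S = (\<Union>J\<in>\<D>. T J) \<union> r ` K"
  have fin\<D>: "finite \<D>"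
    unfolding \<D>_def I_def using finK by (auto intro: finite_subset[of _ "Pow K"])
  have "card (\<Union>J\<in>\<D>. T J) \<le> (\<Sum>J\<in>\<D>. card (T J))"
    using fin\<D> by (rule card_UN_le)
  also have "\<dots> \<le> card \<D> * (d + 1)"
    using T(2) sum_bounded_above[of \<D> "\<lambda>J. card (T J)" "d + 1"] by simp
  also have "\<dots> \<le> (d + 1) * eta d k"
    unfolding mult.commute[of "d + 1"] using card\<D> by (rule mult_le_mono1)
  finally have "card (\<Union>J\<in>\<D>. T J) \<le> (d + 1) * eta d k" .
  moreover have "card (r ` K) \<le> k"
    using card_image_le[OF finK] cardK le_trans by blast
  ultimately have "card S \<le> (d + 1) * eta d k + k"
    unfolding S_def by (meson add_mono card_Un_le le_trans)
  moreover have SX: "S \<subseteq> X"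
    using T(1) r unfolding S_def by blast
  ultimately have part: "partitionable_along_colors c S"
    using assms(5) by blast
  have rS: "r m \<in> S" if "m \<in> K" for m
    using that by (simp add: S_def)
  have "\<exists>D. c (r i) \<in> D \<and> c (r j) \<notin> D \<and>
      strictly_separable {x\<in>S. c x \<in> D} {x\<in>S. c x \<notin> D}"
    using part[unfolded partitionable_along_colors_iff, rule_format, OF rS[OF ij(1)] rS[OF ij(2)]]
      r(2) ij by simp
  then obtain D where D: "i \<in> D" "j \<notin> D"
    and sep: "strictly_separable {x\<in>S. c x \<in> D} {x\<in>S. c x \<notin> D}"
    using r(2) ij by auto
  \<comment> \<open>Since \<open>S\<close> contains all representatives, this \<open>J\<close>
    belongs to \<open>\<D>\<close>; since \<open>S\<close> also contains \<open>T J\<close>,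
    separating \<open>S\<close> along \<open>D\<close> contradicts the choice of
    \<open>T J\<close>.\<close>
  define J where "J = D \<inter> I"
  have JD: "c x \<in> insert i J \<longleftrightarrow> c x \<in> D" if "x \<in> X" for x
    using that D by (auto simp: J_def I_def K_def)
  have "strictly_separable (r ` insert i J) (r ` insert j (I - J))"
    using sep
  proof (rule strictly_separable_mono)
    show "r ` insert i J \<subseteq> {x\<in>S. c x \<in> D}"
      using r rS ij D by (auto simp: J_def I_def)
    show "r ` insert j (I - J) \<subseteq> {x\<in>S. c x \<notin> D}"
      using r rS ij D by (auto simp: J_def I_def)
  qed
  then have J: "J \<in> \<D>"
    by (simp add: \<D>_def J_def)
  have "strictly_separable (insert (r i) ({x\<in>X. c x \<in> insert i J} \<inter> T J))
          ({x\<in>X. c x \<notin> insert i J} \<inter> T J)"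
    using sep
  proof (rule strictly_separable_mono)
    have TS: "T J \<subseteq> S"
      using J by (auto simp: S_def)
    show "insert (r i) ({x\<in>X. c x \<in> insert i J} \<inter> T J) \<subseteq> {x\<in>S. c x \<in> D}"
      using TS JD r rS ij D by auto
    show "{x\<in>X. c x \<notin> insert i J} \<inter> T J \<subseteq> {x\<in>S. c x \<notin> D}"
      using TS JD by blast
  qed
  then show False
    using T(3) J by blast
qed

end
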